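(* Let $\mathcal T$ be an irreducible toric trinity with black triangles forming a set of size $n$, and let $s$ be a state in a cyclic component of the state transition graph of $\mathcal T$. Then there is an ordering $\Delta_1,\dots,\Delta_n$ of all the black triangles of $\mathcal T$ (each appearing exactly once) such that, starting from $s$, one can successively perform the clockwise moves changing $\Delta_1$, then $\Delta_2$, ..., then $\Delta_n$ (each $\Delta_j$ being a clockwise empty black triangle at the moment it is changed), and the state reached at the end is $s$ again.
   Context: A trinity is a triangulation $\mathcal T$ of a compact connected oriented closed surface $\Sigma$ whose vertices are colored red, green, blue so that the endpoints of every edge have different colors. A toric trinity is a trinity on the torus. A triangle is black if its vertices, read clockwise, appear in the cyclic order blue, green, red; otherwise white. A state of a toric trinity is a bijection between white triangles and vertices matching each white triangle with one of its own vertices. Clock moves: for a black triangle $\Delta$ with vertices $u_1,u_2,u_3$ in clockwise order and $W_i$ the white triangle sharing the edge $u_iu_{i+1}$ with $\Delta$ (indices mod 3), $\Delta$ is a clockwise empty black triangle of $s$ if $s$ matches $W_i$ with $u_{i+1}$ for all $i$, and counter-clockwise empty if $s$ matches $W_i$ with $u_i$ for all $i$. The clockwise move changing a clockwise empty $\Delta$ replaces the pairs $(W_i,u_{i+1})$ by $(W_i,u_i)$ and leaves all other pairs unchanged; the counter-clockwise move is its inverse. (In an irreducible trinity every clock move is of this form.) The state transition graph has the states as vertices with a directed edge $s\to t$ when $t$ is obtained from $s$ by a clockwise move; components are those of the underlying undirected graph. A state is recurrent if it can be returned to by a nonempty sequence of clockwise moves; a component is cyclic if it contains a recurrent state. Irreducibility: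 let $\mathcal F$ be the trinity on $S^2$ with three vertices and two triangles. For a trinity $\mathcal T$, a black triangle $\Delta$ of it and a trinity $\mathcal T_0$ on $S^2$ with a chosen (outer) white triangle, the connected sum $\mathcal T\#\mathcal T_0$ is obtained by removing the interior of $\Delta$ and gluing in $\mathcal T_0$ minus the interior of its outer triangle, matching colors on the boundary. It is trivial if $\mathcal T$ or $\mathcal T_0$ is $\mathcal F$. A trinity is irreducible if it is not $\mathcal F$ and is not a nontrivial connected sum. *)

theory Defs
  imports Main "HOL-Library.FuncSet" "HOL-Combinatorics.Orbits"
begin

text \<open>
  A cellularly embedded graph on a closed oriented surface is encoded as a combinatorial map.
  A dart is an edge together with a direction. Each dart \<open>d\<close> is assigned to the one face
  that is traversed clockwise when its boundary is followed in the direction of \<open>d\<close>.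
  The map \<open>opp\<close> reverses a dart, and \<open>nxt\<close> sends a dart to its successor in the clockwise
  traversal of its face. The colour of a dart is the colour of the vertex at which it starts.
  The field values outside \<open>darts\<close> are irrelevant.

  As \<open>F\<close> below has two triangles with the same three vertices, a triangulation may
  have several edges or triangles with the same vertices.
\<close>

datatype colour = Red | Green | Blue

record 'd cmap =
  darts :: "'d set"
  opp :: "'d \<Rightarrow> 'd"
  nxt :: "'d \<Rightarrow> 'd"
  col :: "'d \<Rightarrow> colour"

text \<open>
  If \<open>d\<close> starts at \<open>u\<close>, then \<open>opp d\<close> ends at \<open>u\<close>, so \<open>nxt (opp d)\<close> starts at \<open>u\<close> again:
  a vertex is represented by the set of all darts starting there.
\<close>

definition vertex :: "'d cmap \<Rightarrow> 'd \<Rightarrow> 'd set" where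
  "vertex T d = orbit (nxt T \<circ> opp T) d"

definition edge :: "'d cmap \<Rightarrow> 'd \<Rightarrow> 'd set" where
  "edge T d = orbit (opp T) d"

definition face :: "'d cmap \<Rightarrow> 'd \<Rightarrow> 'd set" where
  "face T d = orbit (nxt T) d"

definition vertices :: "'d cmap \<Rightarrow> 'd set set" where
  "vertices T = vertex T ` darts T"

definition edges :: "'d cmap \<Rightarrow> 'd set set" where
  "edges T = edge T ` darts T"

definition faces :: "'d cmap \<Rightarrow> 'd set set" where
  "faces T = face T ` darts T"

definition connected_map :: "'d cmap \<Rightarrow> bool" where
  "connected_map T \<longleftrightarrow>
     (\<forall>d\<in>darts T. \<forall>d'\<in>darts T.
        (d, d') \<in> {(x, y). x \<in> darts T \<and> (y = opp T x \<or> y = nxt T x)}\<^sup>*)"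

text \<open>
  The last two conditions say that the colour depends only on the starting vertex, and that the
  two endpoints of an edge have different colours.
\<close>

definition trinity :: "'d cmap \<Rightarrow> bool" where
  "trinity T \<longleftrightarrow>
     finite (darts T) \<and> darts T \<noteq> {} \<and>
     opp T \<in> darts T \<rightarrow> darts T \<and> nxt T \<in> darts T \<rightarrow> darts T \<and>
     (\<forall>d\<in>darts T. opp T d \<noteq> d \<and> opp T (opp T d) = d) \<and>
     (\<forall>d\<in>darts T. nxt T d \<noteq> d \<and> nxt T (nxt T (nxt T d)) = d) \<and>
     connected_map T \<and>
     (\<forall>d\<in>darts T. col T (nxt T (opp T d)) = col T d) \<and>
     (\<forall>d\<in>darts T. col T (opp T d) \<noteq> col T d)"

text \<open>The closed oriented connected surface is determined by its Euler characteristic.\<close>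

definition euler_char :: "'d cmap \<Rightarrow> int" where
  "euler_char T = int (card (vertices T)) - int (card (edges T)) + int (card (faces T))"

definition spherical_trinity :: "'d cmap \<Rightarrow> bool" where
  "spherical_trinity T \<longleftrightarrow> trinity T \<and> euler_char T = 2"

definition toric_trinity :: "'d cmap \<Rightarrow> bool" where
  "toric_trinity T \<longleftrightarrow> trinity T \<and> euler_char T = 0"

definition black_triangles :: "'d cmap \<Rightarrow> 'd set set" where
  "black_triangles T =
     {f \<in> faces T. \<exists>d\<in>f. col T d = Blue \<and> col T (nxt T d) = Green \<and>
        col T (nxt T (nxt T d)) = Red}"

definition white_triangles :: "'d cmap \<Rightarrow> 'd set set" where
  "white_triangles T = faces T - black_triangles T"

text \<open>States are extensional so that equality of states is equality of the matchings.\<close>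

definition states :: "'d cmap \<Rightarrow> ('d set \<Rightarrow> 'd set) set" where
  "states T =
     {s \<in> extensional (white_triangles T).
        bij_betw s (white_triangles T) (vertices T) \<and>
        (\<forall>W\<in>white_triangles T. s W \<in> vertex T ` W)}"

text \<open>
  For a dart \<open>d\<close> of the black triangle \<open>\<Delta>\<close> starting at \<open>u\<^sub>i\<close>, the vertex \<open>u\<^sub>i\<^sub>+\<^sub>1\<close> is where
  \<open>nxt d\<close> starts, and \<open>W\<^sub>i\<close> is the face of \<open>opp d\<close>.
\<close>

definition cw_empty :: "'d cmap \<Rightarrow> ('d set \<Rightarrow> 'd set) \<Rightarrow> 'd set \<Rightarrow> bool" where
  "cw_empty T s \<Delta> \<longleftrightarrow>
     \<Delta> \<in> black_triangles T \<and> (\<forall>d\<in>\<Delta>. s (face T (opp T d)) = vertex T (nxt T d))"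

definition cw_move ::
  "'d cmap \<Rightarrow> 'd set \<Rightarrow> ('d set \<Rightarrow> 'd set) \<Rightarrow> ('d set \<Rightarrow> 'd set) \<Rightarrow> bool" where
  "cw_move T \<Delta> s t \<longleftrightarrow>
     s \<in> states T \<and> t \<in> states T \<and> cw_empty T s \<Delta> \<and>
     (\<forall>d\<in>\<Delta>. t (face T (opp T d)) = vertex T d) \<and>
     (\<forall>W. W \<notin> (\<lambda>d. face T (opp T d)) ` \<Delta> \<longrightarrow> t W = s W)"

definition transitions :: "'d cmap \<Rightarrow> ('d set \<Rightarrow> 'd set) rel" where
  "transitions T = {(s, t). \<exists>\<Delta>. cw_move T \<Delta> s t}"

definition state_component :: "'d cmap \<Rightarrow> ('d set \<Rightarrow> 'd set) set \<Rightarrow> bool" where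
  "state_component T C \<longleftrightarrow>
     (\<exists>s\<in>states T. C = {t \<in> states T. (s, t) \<in> (transitions T \<union> (transitions T)\<inverse>)\<^sup>*})"

definition recurrent :: "'d cmap \<Rightarrow> ('d set \<Rightarrow> 'd set) \<Rightarrow> bool" where
  "recurrent T s \<longleftrightarrow> s \<in> states T \<and> (s, s) \<in> (transitions T)\<^sup>+"

definition cyclic_component :: "'d cmap \<Rightarrow> ('d set \<Rightarrow> 'd set) set \<Rightarrow> bool" where
  "cyclic_component T C \<longleftrightarrow> state_component T C \<and> (\<exists>s\<in>C. recurrent T s)"

definition trinity_iso :: "'a cmap \<Rightarrow> 'b cmap \<Rightarrow> bool" where
  "trinity_iso T T' \<longleftrightarrow>
     (\<exists>f. bij_betw f (darts T) (darts T') \<and>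
        (\<forall>d\<in>darts T. f (opp T d) = opp T' (f d) \<and> f (nxt T d) = nxt T' (f d) \<and>
           col T' (f d) = col T d))"

text \<open>These properties determine the trinity up to isomorphism.\<close>

definition is_F :: "'d cmap \<Rightarrow> bool" where
  "is_F T \<longleftrightarrow> spherical_trinity T \<and> card (vertices T) = 3 \<and> card (faces T) = 2"

text \<open>
  A side \<open>d\<close> of a black triangle and a side \<open>e\<close> of a white triangle are glued when the colours of
  their endpoints agree; the two triangles lie on opposite sides of the common edge, so \<open>d\<close> and
  \<open>e\<close> run in opposite directions.
\<close>

definition same_side :: "'a cmap \<Rightarrow> 'a \<Rightarrow> 'b cmap \<Rightarrow> 'b \<Rightarrow> bool" where
  "same_side T d T\<^sub>0 e \<longleftrightarrow> col T\<^sub>0 e = col T (nxt T d) \<and> col T\<^sub>0 (nxt T\<^sub>0 e) = col T d"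

text \<open>
  The black triangle \<open>\<Delta>\<close> of \<open>T\<close> and the white triangle \<open>W\<close> of \<open>T\<^sub>0\<close> are removed. A remaining
  dart whose opposite belonged to a removed triangle gets as its new opposite the remaining dart
  on the other side of the glued edge.
\<close>

definition connected_sum ::
  "'a cmap \<Rightarrow> 'a set \<Rightarrow> 'b cmap \<Rightarrow> 'b set \<Rightarrow> ('a + 'b) cmap" where
  "connected_sum T \<Delta> T\<^sub>0 W =
     \<lparr> darts = Inl ` (darts T - \<Delta>) \<union> Inr ` (darts T\<^sub>0 - W),
       opp = case_sum
         (\<lambda>x. if opp T x \<in> \<Delta>
              then Inr (opp T\<^sub>0 (THE e. e \<in> W \<and> same_side T (opp T x) T\<^sub>0 e))
              else Inl (opp T x))
         (\<lambda>y. if opp T\<^sub>0 y \<in> W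
              then Inl (opp T (THE d. d \<in> \<Delta> \<and> same_side T d T\<^sub>0 (opp T\<^sub>0 y)))
              else Inr (opp T\<^sub>0 y)),
       nxt = case_sum (\<lambda>x. Inl (nxt T x)) (\<lambda>y. Inr (nxt T\<^sub>0 y)),
       col = case_sum (col T) (col T\<^sub>0) \<rparr>"

text \<open>
  Every finite map is isomorphic to one whose darts are natural numbers, so it is no restriction
  to take the summands of this type.
\<close>

definition nontrivial_sum :: "'d cmap \<Rightarrow> bool" where
  "nontrivial_sum T \<longleftrightarrow>
     (\<exists>(T\<^sub>1 :: nat cmap) \<Delta> (T\<^sub>0 :: nat cmap) W.
        trinity T\<^sub>1 \<and> \<Delta> \<in> black_triangles T\<^sub>1 \<and>
        spherical_trinity T\<^sub>0 \<and> W \<in> white_triangles T\<^sub>0 \<and>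
        \<not> is_F T\<^sub>1 \<and> \<not> is_F T\<^sub>0 \<and>
        trinity_iso T (connected_sum T\<^sub>1 \<Delta> T\<^sub>0 W))"

definition irreducible_trinity :: "'d cmap \<Rightarrow> bool" where
  "irreducible_trinity T \<longleftrightarrow> trinity T \<and> \<not> is_F T \<and> \<not> nontrivial_sum T"

end

theory Submission
  imports Defs
begin

text \<open>
  In a white triangle a state marks one corner, and a clockwise move at an adjacent black triangle
  advances the mark to the next corner. So between the three sides of a white triangle the moves
  happen in cyclic order. A closed sequence of moves therefore changes adjacent black triangles
  equally often, and by connectedness it changes all of them. Keeping only the first occurrence of
  each black triangle preserves the cyclic order at every white triangle, so what remains is a
  sequence of legal moves that advances each mark three times, back to where it started. Hence the
  conclusion holds for \<open>s\<close> as soon as some sequence of legal moves from \<open>s\<close> changes every black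
  triangle. This property passes from \<open>t\<close> to \<open>s\<close> along a move \<open>s \<rightarrow> t\<close> by prepending the move, and
  from \<open>s\<close> to \<open>t\<close> because moves at different black triangles commute.
\<close>

text \<open>The cyclic order of the colours read clockwise around a black triangle.\<close>

fun succ_colour :: "colour \<Rightarrow> colour" where
  "succ_colour Blue = Green"
| "succ_colour Green = Red"
| "succ_colour Red = Blue"

section \<open>Sequences of clockwise moves\<close>

fun run :: "'d cmap \<Rightarrow> 'd set list \<Rightarrow> ('d set \<Rightarrow> 'd set) \<Rightarrow> ('d set \<Rightarrow> 'd set) \<Rightarrow> bool" where
  "run T [] s t \<longleftrightarrow> s \<in> states T \<and> t = s"
| "run T (\<Delta> # xs) s t \<longleftrightarrow> (\<exists>u. cw_move T \<Delta> s u \<and> run T xs u t)"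

lemma run_append: "run T (xs @ ys) s t \<longleftrightarrow> (\<exists>u. run T xs s u \<and> run T ys u t)"
proof (induction xs arbitrary: s)
  case Nil
  have "run T ys s t \<Longrightarrow> s \<in> states T"
    by (cases ys) (auto simp: cw_move_def)
  then show ?case by auto
qed auto

lemma run_single: "run T [\<Delta>] s t \<longleftrightarrow> cw_move T \<Delta> s t"
  by (auto simp: cw_move_def)

lemma run_states: "run T xs s t \<Longrightarrow> s \<in> states T \<and> t \<in> states T"
  by (induction xs arbitrary: s) (auto simp: cw_move_def)

lemma set_run_subset: "run T xs s t \<Longrightarrow> set xs \<subseteq> black_triangles T"
  by (induction xs arbitrary: s) (auto simp: cw_move_def cw_empty_def)

lemma run_of_trancl:
  assumes "(s, t) \<in> (transitions T)\<^sup>+"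
  shows "\<exists>xs. xs \<noteq> [] \<and> run T xs s t"
  using assms
proof (induction rule: trancl_induct)
  case (base t)
  then obtain \<Delta> where "cw_move T \<Delta> s t" by (auto simp: transitions_def)
  then have "run T [\<Delta>] s t" by (simp add: run_single del: run.simps)
  then show ?case by blast
next
  case (step t u)
  then obtain xs \<Delta> where "xs \<noteq> []" "run T xs s t" "cw_move T \<Delta> t u"
    by (auto simp: transitions_def)
  then have "run T (xs @ [\<Delta>]) s u"
    unfolding run_append run_single by blast
  then show ?case by blast
qed

lemma run_intermediate_states:
  assumes "run T xs s t"
  shows "\<exists>\<sigma>. \<sigma> 0 = s \<and> \<sigma> (length xs) = t \<and>
           (\<forall>j<length xs. cw_move T (xs ! j) (\<sigma> j) (\<sigma> (Suc j)))"
  using assms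
proof (induction xs arbitrary: s)
  case Nil
  then show ?case by (intro exI[of _ "\<lambda>_. s"]) auto
next
  case (Cons \<Delta> xs)
  then obtain u \<sigma> where u: "cw_move T \<Delta> s u" "\<sigma> 0 = u" "\<sigma> (length xs) = t"
      "\<forall>j<length xs. cw_move T (xs ! j) (\<sigma> j) (\<sigma> (Suc j))"
    by (metis run.simps(2))
  show ?case
    by (rule exI[of _ "case_nat s \<sigma>"])
       (use u in \<open>auto simp: less_Suc_eq_0_disj\<close>)
qed

lemma cw_move_unique:
  assumes "cw_move T \<Delta> s t" "cw_move T \<Delta> s t'"
  shows "t = t'"
proof
  fix W
  show "t W = t' W"
    using assms unfolding cw_move_def by (cases "W \<in> (\<lambda>d. face T (opp T d)) ` \<Delta>") auto
qed

lemma distinct_count_list: "distinct xs \<Longrightarrow> count_list xs x = (if x \<in> set xs then 1 else 0)"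
  by (induction xs) auto

section \<open>Faces, vertices and colours of a trinity\<close>

locale trinity_map =
  fixes T :: "'d cmap"
  assumes trinity: "trinity T"
begin

abbreviation D :: "'d set" where "D \<equiv> darts T"
abbreviation N :: "'d \<Rightarrow> 'd" where "N \<equiv> nxt T"
abbreviation R :: "'d \<Rightarrow> 'd" where "R \<equiv> opp T"

lemma finite_darts: "finite D"
  and nxt_in [simp]: "d \<in> D \<Longrightarrow> N d \<in> D"
  and opp_in [simp]: "d \<in> D \<Longrightarrow> R d \<in> D"
  and opp_opp [simp]: "d \<in> D \<Longrightarrow> R (R d) = d"
  and nxt3 [simp]: "d \<in> D \<Longrightarrow> N (N (N d)) = d"
  and nxt_neq [simp]: "d \<in> D \<Longrightarrow> N d \<noteq> d"
  and col_nxt_opp [simp]: "d \<in> D \<Longrightarrow> col T (N (R d)) = col T d"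
  and col_opp_neq: "d \<in> D \<Longrightarrow> col T (R d) \<noteq> col T d"
  and connected: "connected_map T"
  using trinity unfolding trinity_def by (auto simp: Pi_iff)

lemma col_opp: "d \<in> D \<Longrightarrow> col T (R d) = col T (N d)"
  using col_nxt_opp[of "R d"] by simp

lemma col_nxt_neq: "d \<in> D \<Longrightarrow> col T (N d) \<noteq> col T d"
  using col_opp_neq col_opp by metis

lemma face_eq: "d \<in> D \<Longrightarrow> face T d = {d, N d, N (N d)}"
proof -
  assume d: "d \<in> D"
  have "x \<in> {d, N d, N (N d)}" if "x \<in> orbit N d" for x
    using that by induction (use d in auto)
  moreover have "N d \<in> orbit N d" "N (N d) \<in> orbit N d" "N (N (N d)) \<in> orbit N d"
    by (auto intro: orbit.intros)
  ultimately show ?thesis using d unfolding face_def by auto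
qed

lemma face_nxt [simp]: "d \<in> D \<Longrightarrow> face T (N d) = face T d"
  by (auto simp: face_eq)

lemma face_cong: "d \<in> D \<Longrightarrow> x \<in> face T d \<Longrightarrow> face T x = face T d"
  by (auto simp: face_eq)

lemma self_in_face: "d \<in> D \<Longrightarrow> d \<in> face T d"
  by (simp add: face_eq)

text \<open>\<open>orbit\<close> collects only positive iterates, so finiteness is needed here: two
  iterates of \<open>N \<circ> R\<close> at \<open>d\<close> coincide, and injectivity cancels their
  common part.\<close>

lemma self_in_vertex:
  assumes d: "d \<in> D"
  shows "d \<in> vertex T d"
proof -
  let ?f = "N \<circ> R"
  have D: "(?f ^^ k) d \<in> D" for k
    by (induction k) (use d in auto)
  have "\<not> inj (\<lambda>k. (?f ^^ k) d)"
    using finite_subset[of "range (\<lambda>k. (?f ^^ k) d)" D] D finite_darts finite_imageD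
    by (metis (no_types, lifting) image_subsetI infinite_UNIV_nat)
  then obtain i j where ij: "i < j" "(?f ^^ i) d = (?f ^^ j) d"
    unfolding inj_def by (metis linorder_neqE_nat)
  have inj: "inj_on ?f D"
    by (rule inj_on_inverseI[of _ "R \<circ> N \<circ> N"]) simp
  have "(?f ^^ i) d = (?f ^^ (i + k)) d \<Longrightarrow> d = (?f ^^ k) d" for i k
  proof (induction i)
    case (Suc i)
    have "?f ((?f ^^ i) d) = ?f ((?f ^^ (i + k)) d)"
      using Suc.prems unfolding add_Suc funpow.simps comp_apply[of ?f] .
    then have "(?f ^^ i) d = (?f ^^ (i + k)) d"
      by (rule inj_onD[OF inj _ D D])
    then show ?case by (rule Suc.IH)
  qed simp
  moreover have "i + (j - i) = j" using ij by simp
  ultimately have "d = (?f ^^ (j - i)) d" using ij(2) by metis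
  then show ?thesis unfolding vertex_def orbit_altdef using ij(1) zero_less_diff by blast
qed

lemma col_vertex: "d \<in> D \<Longrightarrow> x \<in> vertex T d \<Longrightarrow> x \<in> D \<and> col T x = col T d"
proof -
  assume d: "d \<in> D"
  assume "x \<in> vertex T d"
  then show ?thesis unfolding vertex_def
    by induction (use d in auto)
qed

text \<open>Both \<open>N d\<close> and \<open>R d\<close> start where \<open>d\<close> ends, and
  one rotation \<open>N \<circ> R\<close> takes \<open>R d\<close> to \<open>N d\<close>.\<close>

lemma vertex_nxt: "d \<in> D \<Longrightarrow> vertex T (N d) = vertex T (R d)"
proof -
  assume d: "d \<in> D"
  have "R d \<in> orbit (N \<circ> R) (R d)"
    using self_in_vertex[of "R d"] d by (simp add: vertex_def)
  then have "orbit (N \<circ> R) ((N \<circ> R) (R d)) = orbit (N \<circ> R) (R d)"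
    by (metis self_in_orbit_step)
  then show ?thesis using d unfolding vertex_def by simp
qed

text \<open>The three corners of a triangle have different colours, while the colour is constant on
  a vertex. Hence a vertex occurs at most once in a face, and the mark that a state puts in a white
  triangle is a single dart.\<close>

lemma dart_eqI:
  assumes "d \<in> D" "e \<in> D" "face T d = face T e" "vertex T d = vertex T e"
  shows "d = e"
proof -
  have "col T d = col T e"
    using assms self_in_vertex col_vertex by metis
  moreover have "e \<in> {d, N d, N (N d)}"
    using assms self_in_face face_eq by metis
  moreover have "col T (N d) \<noteq> col T d" "col T (N (N d)) \<noteq> col T d"
    using assms(1) col_nxt_neq[of d] col_nxt_neq[of "N (N d)"] by auto
  ultimately show ?thesis by auto
qed

text \<open>Consecutive corners differ in colour, so only two cyclic orders are possible, and any
  one side tells which of them occurs.\<close>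

lemma black_iff:
  assumes d: "d \<in> D"
  shows "face T d \<in> black_triangles T \<longleftrightarrow> col T (N d) = succ_colour (col T d)"
proof -
  have "face T d \<in> faces T" using d by (auto simp: faces_def)
  then show ?thesis
    using d col_nxt_neq[of d] col_nxt_neq[of "N d"] col_nxt_neq[of "N (N d)"]
    unfolding black_triangles_def
    by (cases "col T d"; cases "col T (N d)"; cases "col T (N (N d))") (auto simp: face_eq)
qed

lemma white_iff: "d \<in> D \<Longrightarrow> face T d \<in> white_triangles T \<longleftrightarrow> face T d \<notin> black_triangles T"
  by (auto simp: white_triangles_def faces_def)

text \<open>The two sides of an edge read its pair of colours in opposite orders, and exactly one of
  these orders follows \<open>succ_colour\<close>.\<close>

lemma black_opp_iff:
  assumes d: "d \<in> D"
  shows "face T (R d) \<in> black_triangles T \<longleftrightarrow> face T d \<notin> black_triangles T"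
  using d col_nxt_neq[of d] black_iff[of d] black_iff[of "R d"] col_opp[of d]
  by (cases "col T d"; cases "col T (N d)") auto

lemma black_darts:
  assumes "\<Delta> \<in> black_triangles T" "d \<in> \<Delta>"
  shows "d \<in> D" "face T d = \<Delta>" "face T (R d) \<in> white_triangles T"
proof -
  from assms obtain e where e: "e \<in> D" "\<Delta> = face T e"
    by (auto simp: black_triangles_def faces_def)
  then show d: "d \<in> D" using assms face_eq by auto
  show f: "face T d = \<Delta>" using e assms face_cong by blast
  show "face T (R d) \<in> white_triangles T"
    using d f assms by (simp add: white_iff black_opp_iff)
qed

section \<open>Existence and commutation of moves\<close>

lemma cw_empty_opp_face_inj:
  assumes s: "cw_empty T s \<Delta>" "cw_empty T s \<Delta>'" and d: "d \<in> \<Delta>" "d' \<in> \<Delta>'"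
    and eq: "face T (R d) = face T (R d')"
  shows "d = d'"
proof -
  have b: "\<Delta> \<in> black_triangles T" "\<Delta>' \<in> black_triangles T"
    and v: "s (face T (R d)) = vertex T (N d)" "s (face T (R d')) = vertex T (N d')"
    using s d by (auto simp: cw_empty_def)
  have D: "d \<in> D" "d' \<in> D" using b d black_darts by auto
  \<comment> \<open>The mark in this white triangle is the start of both \<open>R d\<close> and
    \<open>R d'\<close>. For \<open>\<Delta> = \<Delta>'\<close> the result says that the three
    neighbours are distinct, and for different triangles that they share no neighbour.\<close>
  have "R d = R d'"
    using v eq D by (intro dart_eqI) (auto simp: vertex_nxt)
  then show ?thesis using D opp_opp by metis
qed

text \<open>Before and after the move, the three neighbours of \<open>\<Delta>\<close> are matched
  with exactly the three corners of \<open>\<Delta>\<close>. So the move only permutes values, and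
  the result is again a bijection.\<close>

lemma cw_move_exists:
  assumes s: "s \<in> states T" and e: "cw_empty T s \<Delta>"
  shows "\<exists>t. cw_move T \<Delta> s t"
proof -
  have b: "\<Delta> \<in> black_triangles T" using e by (simp add: cw_empty_def)
  define g where "g d = face T (R d)" for d
  \<comment> \<open>\<open>g\<close> sends a side of \<open>\<Delta>\<close> to the white triangle
    across it. The inverse of \<open>g\<close> recovers the side whose starting vertex is the new
    value.\<close>
  define t where
    "t W = (if W \<in> g ` \<Delta> then vertex T (the_inv_into \<Delta> g W) else s W)" for W
  have inj: "inj_on g \<Delta>"
    using cw_empty_opp_face_inj[OF e e] by (auto simp: inj_on_def g_def)
  have tg: "t (g d) = vertex T d" if "d \<in> \<Delta>" for d
    using that inj by (simp add: t_def the_inv_into_f_f)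
  have sg: "s (g d) = vertex T (N d)" if "d \<in> \<Delta>" for d
    using that e by (simp add: cw_empty_def g_def)
  have to: "t W = s W" if "W \<notin> g ` \<Delta>" for W using that by (simp add: t_def)
  have gw: "g ` \<Delta> \<subseteq> white_triangles T"
    using b black_darts by (auto simp: g_def)
  obtain d where d: "d \<in> D" "\<Delta> = {d, N d, N (N d)}"
    using b by (auto simp: black_triangles_def faces_def face_eq)
  have bs: "bij_betw s (white_triangles T) (vertices T)"
    and se: "s \<in> extensional (white_triangles T)"
    and sv: "\<And>W. W \<in> white_triangles T \<Longrightarrow> s W \<in> vertex T ` W"
    using s by (auto simp: states_def)
  have N\<Delta>: "N ` \<Delta> = \<Delta>" using d by auto
  have img: "s ` g ` \<Delta> = vertex T ` \<Delta>"
  proof -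
    have "s ` g ` \<Delta> = vertex T ` N ` \<Delta>"
      using sg by (auto simp: image_iff)
    then show ?thesis using N\<Delta> by simp
  qed
  have vinj: "inj_on (vertex T) \<Delta>"
    using dart_eqI black_darts[OF b] by (auto simp: inj_on_def)
  have "bij_betw t (g ` \<Delta>) (vertex T ` \<Delta>)"
  proof -
    have "inj_on t (g ` \<Delta>)"
      using tg vinj by (auto simp: inj_on_def)
    moreover have "t ` g ` \<Delta> = vertex T ` \<Delta>"
      using tg by (auto simp: image_iff)
    ultimately show ?thesis by (simp add: bij_betw_def)
  qed
  moreover have "bij_betw t (white_triangles T - g ` \<Delta>) (vertices T - vertex T ` \<Delta>)"
  proof -
    have "bij_betw s (white_triangles T - g ` \<Delta>) (vertices T - vertex T ` \<Delta>)"
      using gw img bs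
      by (smt (verit) bij_betw_def inj_on_subset inj_on_image_set_diff Diff_subset)
    then show ?thesis by (rule bij_betw_cong[THEN iffD1, rotated]) (simp add: to)
  qed
  ultimately have "bij_betw t (g ` \<Delta> \<union> (white_triangles T - g ` \<Delta>))
      (vertex T ` \<Delta> \<union> (vertices T - vertex T ` \<Delta>))"
    by (rule bij_betw_combine) auto
  moreover have "vertex T ` \<Delta> \<subseteq> vertices T"
    using black_darts[OF b] by (auto simp: vertices_def)
  ultimately have "bij_betw t (white_triangles T) (vertices T)"
    using gw by (simp add: Un_absorb1)
  moreover have "t \<in> extensional (white_triangles T)"
  proof -
    have "t W = undefined" if "W \<notin> white_triangles T" for W
    proof -
      have "W \<notin> g ` \<Delta>" using gw that by blast
      then show ?thesis using to extensional_arb[OF se that] by simp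
    qed
    then show ?thesis by (simp add: extensional_def)
  qed
  moreover have "t W \<in> vertex T ` W" if W: "W \<in> white_triangles T" for W
  proof (cases "W \<in> g ` \<Delta>")
    case True
    then obtain d where d: "d \<in> \<Delta>" "W = g d" by auto
    then have "d \<in> D" using b black_darts by blast
    \<comment> \<open>The old mark of \<open>W\<close> is the corner \<open>R d\<close>; the new one
      is the next corner \<open>N (R d)\<close>, which lies at the start of
      \<open>d\<close>.\<close>
    then have "N (R d) \<in> W" "vertex T (N (R d)) = vertex T d"
      using d by (auto simp: g_def face_eq vertex_nxt)
    then show ?thesis using tg d by (metis image_eqI)
  next
    case False
    then show ?thesis using sv W by (simp add: to)
  qed
  ultimately have "t \<in> states T" by (simp add: states_def)
  then have "cw_move T \<Delta> s t"
    using s e tg to by (auto simp: cw_move_def g_def)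
  then show ?thesis by blast
qed

text \<open>Two triangles that are clockwise empty in the same state have no common white neighbour,
  so each move leaves the other one possible and does not affect its values.\<close>

lemma cw_moves_commute:
  assumes m: "cw_move T \<Delta> s t" "cw_move T \<Delta>' s u" and neq: "\<Delta> \<noteq> \<Delta>'"
  shows "\<exists>v. cw_move T \<Delta>' t v \<and> cw_move T \<Delta> u v"
proof -
  let ?A = "\<lambda>\<Delta>. (\<lambda>d. face T (R d)) ` \<Delta>"
  have e: "cw_empty T s \<Delta>" "cw_empty T s \<Delta>'" using m by (auto simp: cw_move_def)
  then have b: "\<Delta> \<in> black_triangles T" "\<Delta>' \<in> black_triangles T" by (auto simp: cw_empty_def)
  have disj: "?A \<Delta> \<inter> ?A \<Delta>' = {}"
  proof (rule ccontr)
    assume "?A \<Delta> \<inter> ?A \<Delta>' \<noteq> {}"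
    then obtain d d' where "d \<in> \<Delta>" "d' \<in> \<Delta>'" "face T (R d) = face T (R d')" by auto
    then have "d \<in> \<Delta> \<inter> \<Delta>'" using cw_empty_opp_face_inj[OF e] by auto
    then show False using b neq black_darts(2) by blast
  qed
  have t: "t W = s W" if "W \<notin> ?A \<Delta>" for W
    using m(1) that unfolding cw_move_def by blast
  have u: "u W = s W" if "W \<notin> ?A \<Delta>'" for W
    using m(2) that unfolding cw_move_def by blast
  have "face T (R d) \<notin> ?A \<Delta>" if "d \<in> \<Delta>'" for d using disj that by blast
  then have "cw_empty T t \<Delta>'" using e(2) t unfolding cw_empty_def by metis
  moreover have "face T (R d) \<notin> ?A \<Delta>'" if "d \<in> \<Delta>" for d using disj that by blast
  then have "cw_empty T u \<Delta>" using e(1) u unfolding cw_empty_def by metis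
  moreover have "t \<in> states T" "u \<in> states T" using m by (auto simp: cw_move_def)
  ultimately obtain v w where vw: "cw_move T \<Delta>' t v" "cw_move T \<Delta> u w"
    using cw_move_exists by blast
  have "v = w"
  proof
    fix W
    have v: "v W = t W" if "W \<notin> ?A \<Delta>'" using vw(1) that unfolding cw_move_def by blast
    have w: "w W = u W" if "W \<notin> ?A \<Delta>" using vw(2) that unfolding cw_move_def by blast
    have "v W = u W" if "W \<in> ?A \<Delta>'" using vw(1) m(2) that unfolding cw_move_def by force
    moreover have "w W = t W" if "W \<in> ?A \<Delta>" using vw(2) m(1) that unfolding cw_move_def by force
    ultimately show "v W = w W" using v w t u disj by (metis disjoint_iff)
  qed
  then show ?thesis using vw by blast
qed

lemma cw_move_run_commute:
  assumes "run T xs s u" "cw_move T \<Delta> s t" "\<Delta> \<notin> set xs"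
  shows "\<exists>v. run T xs t v \<and> cw_move T \<Delta> u v"
  using assms
proof (induction xs arbitrary: s t)
  case Nil
  then show ?case by (auto simp: cw_move_def)
next
  case (Cons \<Delta>' xs)
  then obtain s' where s': "cw_move T \<Delta>' s s'" "run T xs s' u" by auto
  then obtain t' where "cw_move T \<Delta>' t t'" "cw_move T \<Delta> s' t'"
    using cw_moves_commute Cons.prems by (metis list.set_intros(1))
  then show ?case using Cons.IH s' Cons.prems by (metis list.set_intros(2) run.simps(2))
qed

section \<open>Marks in white triangles\<close>

lemma state_marks_dart:
  assumes "s \<in> states T" "W \<in> white_triangles T"
  obtains e where "e \<in> D" "face T e = W" "s W = vertex T e"
proof -
  obtain e where e: "e \<in> W" "s W = vertex T e"
    using assms by (auto simp: states_def)
  obtain d where "d \<in> D" "W = face T d"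
    using assms by (auto simp: white_triangles_def faces_def)
  then show ?thesis using that e face_cong face_eq by (metis insert_iff nxt_in singletonD)
qed

text \<open>A clockwise empty triangle across a side \<open>g\<close> of a white triangle requires
  the mark at the start of \<open>g\<close>. With the mark at \<open>f\<close>, the move can
  therefore involve this triangle only across the side \<open>f\<close>, and then the mark advances
  to \<open>N f\<close>.\<close>

lemma cw_move_mark:
  assumes m: "cw_move T \<Delta> s t" and f: "f \<in> D" and s: "s (face T f) = vertex T f"
  shows "t (face T f) = (if face T (R f) = \<Delta> then vertex T (N f) else vertex T f)"
    and "face T (R (N f)) \<noteq> \<Delta>" "face T (R (N (N f))) \<noteq> \<Delta>"
proof -
  have e: "cw_empty T s \<Delta>" using m by (simp add: cw_move_def)
  then have b: "\<Delta> \<in> black_triangles T" by (simp add: cw_empty_def)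
  have *: "g = f" if g: "g \<in> D" "face T g = face T f" "face T (R g) = \<Delta>" for g
  proof -
    have "R g \<in> \<Delta>" using g self_in_face by force
    then have "s (face T g) = vertex T g"
      using e g by (auto simp: cw_empty_def vertex_nxt)
    then show ?thesis using dart_eqI g f s by metis
  qed
  show "face T (R (N f)) \<noteq> \<Delta>" using *[of "N f"] f by auto
  show "face T (R (N (N f))) \<noteq> \<Delta>" using *[of "N (N f)"] f by (metis face_nxt nxt_in nxt_neq nxt3)
  show "t (face T f) = (if face T (R f) = \<Delta> then vertex T (N f) else vertex T f)"
  proof (cases "face T (R f) = \<Delta>")
    case True
    then have "R f \<in> \<Delta>" using f self_in_face[of "R f"] by auto
    then show ?thesis using m True f by (force simp: cw_move_def vertex_nxt)
  next
    case False
    have "face T f \<notin> (\<lambda>d. face T (R d)) ` \<Delta>"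
    proof
      assume "face T f \<in> (\<lambda>d. face T (R d)) ` \<Delta>"
      then obtain d where d: "d \<in> \<Delta>" "face T f = face T (R d)" by auto
      then have "d \<in> D" "face T d = \<Delta>" using b black_darts by auto
      then show False using *[of "R d"] d False by auto
    qed
    then show ?thesis using False m s by (simp add: cw_move_def)
  qed
qed

text \<open>\<open>c d\<close> counts the moves at the triangle across the side \<open>d\<close>.
  Starting from the mark \<open>e\<close>, moves across \<open>e\<close>, \<open>N e\<close>,
  \<open>N (N e)\<close> take turns in this order, so the counts differ by at most one, and the
  three alternatives correspond to the present mark.\<close>

lemma run_counts:
  assumes "run T xs s t" and e: "e \<in> D" "s (face T e) = vertex T e"
  defines "c \<equiv> \<lambda>d. count_list xs (face T (R d))"
  shows "c e = c (N e) \<and> c (N e) = c (N (N e)) \<and> t (face T e) = vertex T e \<or>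
         c e = Suc (c (N e)) \<and> c (N e) = c (N (N e)) \<and> t (face T e) = vertex T (N e) \<or>
         c e = c (N e) \<and> c (N e) = Suc (c (N (N e))) \<and> t (face T e) = vertex T (N (N e))"
  using assms(1) unfolding c_def
proof (induction xs arbitrary: t rule: rev_induct)
  case Nil
  then show ?case using e by simp
next
  case (snoc \<Delta> xs)
  then obtain u where u: "run T xs s u" "cw_move T \<Delta> u t"
    unfolding run_append run_single by blast
  note mark = cw_move_mark[OF u(2)]
  \<comment> \<open>Each alternative of the induction hypothesis names the mark before the last
    move, to which \<open>mark\<close> then applies.\<close>
  from snoc.IH[OF u(1)] show ?case
    using mark[of e] mark[of "N e"] mark[of "N (N e)"] e
    by (elim disjE) (auto split: if_splits)
qed

text \<open>In the induction a repeated triangle is dropped. A new one has to be shown clockwise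
  empty in \<open>u\<close>, although \<open>u\<close> may differ from the state \<open>t'\<close>
  reached with repetitions.\<close>

lemma run_first_moves:
  assumes "run T xs s t"
  shows "\<exists>ys u. run T ys s u \<and> distinct ys \<and> set ys = set xs"
  using assms
proof (induction xs arbitrary: t rule: rev_induct)
  case Nil
  then show ?case by (intro exI[of _ "[]"]) auto
next
  case (snoc \<Delta> xs)
  then obtain t' where t': "run T xs s t'" "cw_move T \<Delta> t' t"
    unfolding run_append run_single by blast
  from snoc.IH[OF t'(1)] obtain ys u where ys: "run T ys s u" "distinct ys" "set ys = set xs"
    by blast
  show ?case
  proof (cases "\<Delta> \<in> set xs")
    case True
    then show ?thesis using ys by (metis insert_absorb list.simps(15) rotate1.simps(2) set_rotate1)
  next
    case False
    have e: "cw_empty T t' \<Delta>" using t' by (simp add: cw_move_def)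
    then have b: "\<Delta> \<in> black_triangles T" by (simp add: cw_empty_def)
    have "u (face T (R d)) = vertex T (N d)" if d: "d \<in> \<Delta>" for d
    proof -
      have D: "d \<in> D" "face T d = \<Delta>" "face T (R d) \<in> white_triangles T"
        using b black_darts d by auto
      have td: "t' (face T (R d)) = vertex T (R d)"
        using e d D by (simp add: cw_empty_def vertex_nxt)
      obtain f where f: "f \<in> D" "face T f = face T (R d)" "s (face T f) = vertex T f"
        using state_marks_dart D(3) run_states[OF ys(1)] by metis
      have sub: "R d \<in> {f, N f, N (N f)}"
        using f D self_in_face[of "R d"] face_eq by auto
      have cnt: "count_list ys X = (if X \<in> set xs then 1 else 0)" for X
        using ys by (simp add: distinct_count_list)
      have zero: "count_list xs X = 0 \<longleftrightarrow> X \<notin> set xs" for X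
        by (simp add: count_list_0_iff)
      \<comment> \<open>The side \<open>R d\<close> carries the mark of \<open>t'\<close> but has
        count 0. By \<open>run_counts\<close> the other two counts are then at most 1, so
        \<open>xs\<close> and \<open>ys\<close> have equal counts around this white triangle and
        lead to the same mark.\<close>
      have zd: "count_list xs (face T (R (R d))) = 0" using False D zero by simp
      have vneq: "vertex T f \<noteq> vertex T (N f)" "vertex T f \<noteq> vertex T (N (N f))"
          "vertex T (N f) \<noteq> vertex T (N (N f))"
        using dart_eqI[of f "N f"] dart_eqI[of f "N (N f)"] dart_eqI[of "N f" "N (N f)"] f
        by (metis face_nxt nxt_in nxt_neq nxt3)+
      have "u (face T f) = vertex T (R d)"
        using run_counts[OF t'(1) f(1,3)] run_counts[OF ys(1) f(1,3)] sub zd td vneq zero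
        unfolding cnt f(2)
        by (elim insertE emptyE) (auto split: if_splits)
      then show ?thesis using f D by (simp add: vertex_nxt)
    qed
    then have "cw_empty T u \<Delta>" using b by (simp add: cw_empty_def)
    then obtain v where "cw_move T \<Delta> u v" using cw_move_exists run_states[OF ys(1)] by blast
    then have "run T (ys @ [\<Delta>]) s v"
      using ys(1) unfolding run_append run_single by blast
    then show ?thesis using ys False by (intro exI[of _ "ys @ [\<Delta>]"]) auto
  qed
qed

section \<open>Closed runs\<close>

lemma full_cycle:
  assumes "run T xs s t" "set xs = black_triangles T"
  shows "\<exists>ys. run T ys s s \<and> distinct ys \<and> set ys = black_triangles T"
proof -
  obtain ys u where ys: "run T ys s u" "distinct ys" "set ys = black_triangles T"
    using run_first_moves assms by metis
  have st: "s \<in> states T" "u \<in> states T" using run_states ys by auto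
  have "u W = s W" if W: "W \<in> white_triangles T" for W
  proof -
    obtain e where e: "e \<in> D" "face T e = W" "s W = vertex T e"
      using state_marks_dart st W by metis
    have "count_list ys (face T (R d)) = 1" if "d \<in> D" "face T d = W" for d
      using that ys W black_opp_iff[of d] white_iff[of d] by (simp add: distinct_count_list)
    \<comment> \<open>Three equal counts leave only the first alternative of
      \<open>run_counts\<close>, in which the mark is back at \<open>e\<close>.\<close>
    then have "count_list ys (face T (R e)) = 1" "count_list ys (face T (R (N e))) = 1"
      "count_list ys (face T (R (N (N e)))) = 1"
      using e by auto
    then show ?thesis using run_counts[OF ys(1), of e] e by auto
  qed
  then have "u = s"
    using st by (intro extensionalityI[of _ "white_triangles T"]) (auto simp: states_def)
  then show ?thesis using ys by blast
qed

text \<open>Returning to \<open>s\<close> forces the first alternative of \<open>run_counts\<close>,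
  so the counts across the sides of each white triangle agree. Connectedness makes the count the
  same for all black triangles, and a nonempty run makes it positive.\<close>

lemma closed_run_all_black:
  assumes r: "run T xs s s" and ne: "xs \<noteq> []"
  shows "set xs = black_triangles T"
proof
  show "set xs \<subseteq> black_triangles T" using set_run_subset r by blast
  \<comment> \<open>The count of the black triangle at the edge of \<open>d\<close>, whichever side
    of the edge it is on; this makes \<open>c\<close> invariant under \<open>R\<close>.\<close>
  define c where "c d = (if face T d \<in> black_triangles T then count_list xs (face T d)
    else count_list xs (face T (R d)))" for d
  have st: "s \<in> states T" using run_states r by blast
  have white: "count_list xs (face T (R (N d))) = count_list xs (face T (R d))"
    if d: "d \<in> D" "face T d \<in> white_triangles T" for d
  proof -
    obtain e where e: "e \<in> D" "face T e = face T d" "s (face T e) = vertex T e"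
      using state_marks_dart st d by metis
    have "vertex T e \<noteq> vertex T (N e)" "vertex T e \<noteq> vertex T (N (N e))"
      using dart_eqI[of e "N e"] dart_eqI[of e "N (N e)"] e
      by (metis face_nxt nxt_in nxt_neq nxt3)+
    then have "count_list xs (face T (R e)) = count_list xs (face T (R (N e)))"
      "count_list xs (face T (R (N e))) = count_list xs (face T (R (N (N e))))"
      using run_counts[OF r e(1,3)] e by auto
    moreover have "d \<in> {e, N e, N (N e)}"
      using d e self_in_face face_eq by metis
    ultimately show ?thesis using e by auto
  qed
  have step: "c (R d) = c d \<and> c (N d) = c d" if "d \<in> D" for d
    using that white[of d] by (auto simp: c_def black_opp_iff white_iff)
  have const: "c d' = c d" if "d \<in> D" "d' \<in> D" for d d'
  proof -
    have "(d, d') \<in> {(x, y). x \<in> D \<and> (y = R x \<or> y = N x)}\<^sup>*"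
      using connected that by (auto simp: connected_map_def)
    then show ?thesis by induction (use step in auto)
  qed
  obtain \<Delta> where \<Delta>: "\<Delta> \<in> set xs" "\<Delta> \<in> black_triangles T"
    using ne set_run_subset[OF r] by (cases xs) auto
  then obtain d where d: "d \<in> D" "face T d = \<Delta>"
    by (auto simp: black_triangles_def faces_def)
  then have pos: "c d \<noteq> 0" using \<Delta> by (simp add: c_def count_list_0_iff)
  show "black_triangles T \<subseteq> set xs"
  proof
    fix \<Delta>' assume \<Delta>': "\<Delta>' \<in> black_triangles T"
    then obtain d' where d': "d' \<in> D" "face T d' = \<Delta>'"
      by (auto simp: black_triangles_def faces_def)
    then have "count_list xs \<Delta>' \<noteq> 0"
      using const[OF d(1) d'(1)] pos \<Delta>' by (simp add: c_def)
    then show "\<Delta>' \<in> set xs" by (simp add: count_list_0_iff)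
  qed
qed

section \<open>Transfer along a component\<close>

definition runs_through_all :: "('d set \<Rightarrow> 'd set) \<Rightarrow> bool" where
  "runs_through_all s \<longleftrightarrow> (\<exists>xs t. run T xs s t \<and> set xs = black_triangles T)"

text \<open>Repetitions and an arbitrary end state are allowed, so prepending the move settles the
  backward direction. Forward, \<open>full_cycle\<close> gives a cycle at \<open>s\<close> using
  \<open>\<Delta>\<close> once; pulling \<open>\<Delta>\<close> to its front and rotating it to the
  end gives a cycle at \<open>t\<close>.\<close>

lemma runs_through_all_cw_move:
  assumes m: "cw_move T \<Delta> s t"
  shows "runs_through_all s \<longleftrightarrow> runs_through_all t"
proof
  have b: "\<Delta> \<in> black_triangles T" using m by (auto simp: cw_move_def cw_empty_def)
  {
    assume "runs_through_all t"
    then obtain xs u where "run T xs t u" "set xs = black_triangles T"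
      by (auto simp: runs_through_all_def)
    then have "run T (\<Delta> # xs) s u" "set (\<Delta> # xs) = black_triangles T"
      using m b by auto
    then show "runs_through_all s" unfolding runs_through_all_def by blast
  }
  assume "runs_through_all s"
  then obtain ys where ys: "run T ys s s" "distinct ys" "set ys = black_triangles T"
    using full_cycle unfolding runs_through_all_def by blast
  then obtain ys1 ys2 where split: "ys = ys1 @ \<Delta> # ys2"
    using b by (metis split_list)
  then have nin: "\<Delta> \<notin> set ys1" using ys by auto
  obtain s1 s2 where s: "run T ys1 s s1" "cw_move T \<Delta> s1 s2" "run T ys2 s2 s"
    using ys(1) unfolding split run_append by auto
  obtain v where v: "run T ys1 t v" "cw_move T \<Delta> s1 v"
    using cw_move_run_commute[OF s(1) m nin] by blast
  \<comment> \<open>Both states arise from \<open>s1\<close> by the move at \<open>\<Delta>\<close>,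
    so the commuted run rejoins the original cycle.\<close>
  have "v = s2" using v s cw_move_unique by blast
  then have "run T (ys1 @ ys2 @ [\<Delta>]) t t"
    unfolding run_append run_single using v s m by blast
  moreover have "set (ys1 @ ys2 @ [\<Delta>]) = black_triangles T"
    using ys split by auto
  ultimately show "runs_through_all t" unfolding runs_through_all_def by blast
qed

lemma runs_through_all_component:
  assumes "(s, t) \<in> (transitions T \<union> (transitions T)\<inverse>)\<^sup>*"
  shows "runs_through_all s \<longleftrightarrow> runs_through_all t"
  using assms
  by induction (auto simp: transitions_def dest: runs_through_all_cw_move)

text \<open>A recurrent state has a nonempty closed run, which hits every black triangle; this
  property spreads over the component to \<open>s\<close>.\<close>

lemma cyclic_component_full_cycle:
  assumes "cyclic_component T C" "s \<in> C"
  shows "\<exists>ys. run T ys s s \<and> distinct ys \<and> set ys = black_triangles T"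
proof -
  from assms obtain s0 r where
    "(s0, s) \<in> (transitions T \<union> (transitions T)\<inverse>)\<^sup>*"
    "(s0, r) \<in> (transitions T \<union> (transitions T)\<inverse>)\<^sup>*" and r: "recurrent T r"
    unfolding cyclic_component_def state_component_def by auto
  then have "runs_through_all s \<longleftrightarrow> runs_through_all r"
    using runs_through_all_component by metis
  moreover have "runs_through_all r"
  proof -
    obtain xs where "xs \<noteq> []" "run T xs r r"
      using r run_of_trancl unfolding recurrent_def by metis
    then show ?thesis
      using closed_run_all_black unfolding runs_through_all_def by blast
  qed
  ultimately show ?thesis using full_cycle unfolding runs_through_all_def by blast
qed

end

theorem theorem5p9:
  fixes T :: "'d cmap" and n :: nat
    and C :: "('d set \<Rightarrow> 'd set) set" and s :: "'d set \<Rightarrow> 'd set"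
  assumes "toric_trinity T"
    and "irreducible_trinity T"
    and "card (black_triangles T) = n"
    and "cyclic_component T C"
    and "s \<in> C"
  shows "\<exists>(\<Delta> :: nat \<Rightarrow> 'd set) (\<sigma> :: nat \<Rightarrow> 'd set \<Rightarrow> 'd set).
           bij_betw \<Delta> {1..n} (black_triangles T) \<and>
           \<sigma> 0 = s \<and>
           (\<forall>j\<in>{1..n}. cw_move T (\<Delta> j) (\<sigma> (j - 1)) (\<sigma> j)) \<and>
           \<sigma> n = s"
proof -
  interpret trinity_map T
    using assms(1) by unfold_locales (simp add: toric_trinity_def)
  obtain ys where ys: "run T ys s s" "distinct ys" "set ys = black_triangles T"
    using cyclic_component_full_cycle assms by blast
  have n: "n = length ys" using ys assms(3) distinct_card by metis
  obtain \<sigma> where \<sigma>: "\<sigma> 0 = s" "\<sigma> (length ys) = s"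
      "\<forall>j<length ys. cw_move T (ys ! j) (\<sigma> j) (\<sigma> (Suc j))"
    using run_intermediate_states[OF ys(1)] by blast
  \<comment> \<open>The ordering is indexed from 1, the list \<open>ys\<close> from 0.\<close>
  have "bij_betw (\<lambda>j. j - 1) {1..n} {..<n}"
    by (rule bij_betw_byWitness[where f' = Suc]) auto
  moreover have "bij_betw ((!) ys) {..<n} (black_triangles T)"
    using bij_betw_nth[OF ys(2)] ys n by blast
  ultimately have "bij_betw ((!) ys \<circ> (\<lambda>j. j - 1)) {1..n} (black_triangles T)"
    by (rule bij_betw_trans)
  moreover have "cw_move T (((!) ys \<circ> (\<lambda>j. j - 1)) j) (\<sigma> (j - 1)) (\<sigma> j)" if "j \<in> {1..n}" for j
    using \<sigma>(3) that n by (cases j) auto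
  ultimately show ?thesis using \<sigma> n by blast
qed

end
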